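(* Let $q$ be a prime power, let $r$ be a positive integer, and let $c,u,v\in\mathbb{F}_{q^2}$ satisfy $c+c^q=0$ and $(u+v)^q=(-1)^{r}(u+v)$. Then $$f(x)=(x^{q}-x+c)^r+ux^{q}+vx$$ is a permutation polynomial of $\mathbb{F}_{q^2}$ if and only if $u^{q+1}\neq v^{q+1}$.
   Context: A polynomial is a permutation polynomial of $\mathbb{F}_{q^2}$ if the map it induces on $\mathbb{F}_{q^2}$ is a bijection. *)

theory Defs
  imports
    "HOL-Computational_Algebra.Polynomial"
    "HOL-Number_Theory.Prime_Powers"
begin

text \<open>The field of coefficients is the whole type, so \<open>poly f\<close> is the map that \<open>f\<close> induces on it.\<close>

definition permutation_polynomial :: "'a::{field,finite} poly \<Rightarrow> bool" where
  "permutation_polynomial f \<longleftrightarrow> bij (poly f)"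

end

theory Submission
  imports Defs
begin

text \<open>
  Write \<open>y = x\<^sup>q - x + c\<close>, \<open>w = u + v\<close>, \<open>e = (-1)\<^sup>r\<close> and \<open>a = u\<^sup>q - e v\<close>. Since \<open>y\<^sup>q = -y\<close>, the
  power \<open>y\<^sup>r\<close> satisfies \<open>(y\<^sup>r)\<^sup>q = e y\<^sup>r\<close>, and therefore
  \<open>f(x)\<^sup>q - e f(x) = -a (y - c)\<close> while \<open>f(x) = y\<^sup>r + u (y - c) + w x\<close>. If \<open>a\<close> and \<open>w\<close> are both
  nonzero, then \<open>f(x)\<close> determines first \<open>y\<close> and then \<open>x\<close>. If \<open>w = 0\<close>, then \<open>f\<close> factors through
  \<open>y\<close>, which is not injective in \<open>x\<close>; if \<open>a = 0\<close>, then the image of \<open>f\<close> lies in the proper subset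
  where \<open>z\<^sup>q = e z\<close>. Finally \<open>u\<^sup>q\<^sup>+\<^sup>1 - v\<^sup>q\<^sup>+\<^sup>1 = w a\<close>.
\<close>

text \<open>Translation by 1 permutes the ring, so it preserves the sum of all elements while adding
  1 once per element.\<close>

lemma of_nat_card_UNIV_eq_0: "of_nat (card (UNIV :: 'a set)) = (0 :: 'a::{ring_1,finite})"
proof -
  have "(\<Sum>x\<in>UNIV. x + 1) = (\<Sum>x\<in>UNIV. x :: 'a)"
    by (rule sum.reindex_bij_witness[of _ "\<lambda>y. y - 1" "\<lambda>x. x + 1"]) auto
  then show ?thesis
    by (simp add: sum.distrib)
qed

lemma CHAR_eq_prime_if_card_power:
  assumes "prime p" "card (UNIV :: 'a::{idom,finite} set) = p ^ k"
  shows "CHAR('a) = p"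
proof -
  have "CHAR('a) dvd p ^ k"
    using of_nat_card_UNIV_eq_0[where ?'a = 'a] assms(2) of_nat_eq_0_iff_char_dvd by metis
  moreover have "prime CHAR('a)"
    by (simp add: finite_imp_CHAR_pos prime_CHAR_semidom)
  ultimately show ?thesis
    using assms(1) prime_dvd_power primes_dvd_imp_eq by blast
qed

text \<open>Multiplication by a nonzero \<open>x\<close> permutes the nonzero elements; cancel their
  product.\<close>

lemma field_power_card_UNIV: "x ^ card (UNIV :: 'a set) = (x :: 'a::{field,finite})"
proof (cases "x = 0")
  case True
  then show ?thesis
    using finite_UNIV_card_ge_0[where ?'a = 'a] by auto
next
  case False
  have "(\<Prod>y\<in>UNIV-{0}. x * y) = \<Prod>(UNIV-{0})"
    by (rule prod.reindex_bij_witness[of _ "\<lambda>y. y / x" "\<lambda>y. x * y"]) (use False in auto)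
  then have "x ^ (card (UNIV :: 'a set) - 1) = 1"
    by (simp add: prod.distrib card_Diff_singleton)
  then show ?thesis
    by (simp add: power_eq_if)
qed

text \<open>Otherwise the nonzero polynomial \<open>X^q - X\<close> would have more roots than its
  degree allows.\<close>

lemma exists_power_neq_self:
  assumes "1 < q" "q < card (UNIV :: 'a::{field,finite} set)"
  shows "\<exists>z::'a. z ^ q \<noteq> z"
proof (rule ccontr)
  assume "\<not> (\<exists>z::'a. z ^ q \<noteq> z)"
  moreover define p :: "'a poly" where "p = monom 1 q - monom 1 1"
  ultimately have roots: "{x. poly p x = 0} = UNIV"
    by (auto simp: poly_monom)
  have "coeff p q = 1"
    using assms(1) by (simp add: p_def)
  then have "p \<noteq> 0"
    by auto
  moreover have "degree p \<le> q"
    unfolding p_def using assms(1) by (intro degree_diff_le) (auto intro: degree_monom_le order_trans)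
  ultimately show False
    using card_poly_roots_bound[of p] roots assms(2) by simp
qed

theorem corollary6:
  fixes q r :: nat
    and c u v :: "'a::{field,finite}"
  assumes "primepow q"
    and "card (UNIV :: 'a set) = q ^ 2"
    and "r > 0"
    and "c + c ^ q = 0"
    and "(u + v) ^ q = (-1) ^ r * (u + v)"
  shows "permutation_polynomial
           ((monom 1 q - monom 1 1 + [:c:]) ^ r + monom u q + monom v 1)
         \<longleftrightarrow> u ^ (q + 1) \<noteq> v ^ (q + 1)"
proof -
  obtain p n where pn: "prime p" "n > 0" "q = p ^ n"
    using assms(1) unfolding primepow_def by blast
  have q: "q > 1"
    using primepow_gt_Suc_0[OF assms(1)] by simp
  have char: "CHAR('a) = p"
    using pn assms(2) by (intro CHAR_eq_prime_if_card_power[of p "n * 2"]) (auto simp: power_mult)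
  have add: "(x + y) ^ q = x ^ q + y ^ q" for x y :: 'a
    using freshmans_dream'[of q n x y] char pn by simp
  \<comment> \<open>Deriving this from additivity avoids a case split on the parity of
    \<open>q\<close>.\<close>
  have neg: "(- x) ^ q = - (x ^ q)" for x :: 'a
    using add[of x "- x"] q by (simp add: eq_neg_iff_add_eq_0 add.commute zero_power)
  have diff: "(x - y) ^ q = x ^ q - y ^ q" for x y :: 'a
    using add[of x "- y"] neg[of y] by simp
  have invol: "(x ^ q) ^ q = x" for x :: 'a
    using field_power_card_UNIV[of x] assms(2) by (simp add: power_mult power2_eq_square)
  obtain z0 :: 'a where z0: "z0 ^ q \<noteq> z0"
    using exists_power_neq_self[OF q, where ?'a = 'a] power_strict_increasing[of 1 2 q] q assms(2)
    by auto

  define e :: 'a where "e = (-1) ^ r"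
  define w where "w = u + v"
  define a where "a = u ^ q - e * v"
  define y where "y x = x ^ q - x + c" for x
  define f where "f x = y x ^ r + u * x ^ q + v * x" for x
  \<comment> \<open>The hypothesis on \<open>u + v\<close>, solved for \<open>v ^ q\<close>,
    eliminates that power from later computations.\<close>
  have vq: "v ^ q = e * u + e * v - u ^ q"
    using assms(5) by (simp add: add e_def algebra_simps)
  have cq: "c ^ q = - c"
    using assms(4) by (simp add: eq_neg_iff_add_eq_0 add.commute)
  have yq: "y x ^ q = - y x" for x
    by (simp add: y_def add diff invol cq)
  have yrq: "(y x ^ r) ^ q = e * y x ^ r" for x
  proof -
    have "(y x ^ r) ^ q = (- y x) ^ r"
      by (metis yq mult.commute power_mult)
    also have "\<dots> = e * y x ^ r"
      unfolding e_def by (rule power_minus)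
    finally show ?thesis .
  qed
  have f_frob: "f x ^ q - e * f x = a * (c - y x)" for x
  proof -
    have c_diff: "c - y x = x - x ^ q"
      by (simp add: y_def)
    have f_pow: "f x ^ q = e * y x ^ r + u ^ q * x + v ^ q * x ^ q"
      by (simp add: f_def add power_mult_distrib invol yrq)
    show ?thesis
      unfolding f_pow c_diff by (simp add: f_def vq a_def algebra_simps)
  qed
  have f_eq: "f x = y x ^ r + u * (y x - c) + w * x" for x
    by (simp add: f_def y_def w_def algebra_simps)

  have "permutation_polynomial
           ((monom 1 q - monom 1 1 + [:c:]) ^ r + monom u q + monom v 1) \<longleftrightarrow> bij f"
    unfolding permutation_polynomial_def
    by (rule arg_cong[where f = bij]) (auto simp: fun_eq_iff f_def y_def poly_monom)
  also have "bij f \<longleftrightarrow> w \<noteq> 0 \<and> a \<noteq> 0"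
  proof
    assume "bij f"
    have "w \<noteq> 0"
    proof
      assume "w = 0"
      \<comment> \<open>Both 0 and 1 are fixed by the \<open>q\<close>-th power map, so
        \<open>y 0 = y 1 = c\<close>.\<close>
      then have "f 0 = f 1"
        using q by (simp add: f_eq y_def zero_power)
      then show False
        using \<open>bij f\<close> by (metis bij_is_inj injD zero_neq_one)
    qed
    moreover have "a \<noteq> 0"
    proof
      assume "a = 0"
      then have *: "z ^ q = e * z" for z
      proof -
        obtain x where "z = f x"
          using \<open>bij f\<close> by (metis bij_pointE)
        then show ?thesis
          using f_frob[of x] \<open>a = 0\<close> by simp
      qed
      \<comment> \<open>With \<open>e = 1\<close> the \<open>q\<close>-th power map would be the
        identity, which \<open>z0\<close> refutes.\<close>
      have "e = 1"
        using *[of 1] by simp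
      then show False
        using * z0 by simp
    qed
    ultimately show "w \<noteq> 0 \<and> a \<noteq> 0" ..
  next
    assume nz: "w \<noteq> 0 \<and> a \<noteq> 0"
    have "inj f"
    proof (rule injI)
      fix x x' assume eq: "f x = f x'"
      then have "a * (c - y x) = a * (c - y x')"
        using f_frob by metis
      then have "y x = y x'"
        using nz by simp
      then show "x = x'"
        using eq nz by (simp add: f_eq)
    qed
    then show "bij f"
      by (simp add: bij_def finite_UNIV_inj_surj)
  qed
  also have "\<dots> \<longleftrightarrow> w * a \<noteq> 0"
    by simp
  also have "w * a = u ^ (q + 1) - v ^ (q + 1)"
    by (simp add: w_def a_def vq algebra_simps)
  finally show ?thesis
    by simp
qed

end
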